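(* Let $p\ge 1$. Any perfect $L_p$ sampler for a vector distributed across $k$ servers must use $\Omega(k^{\max(1,p-1)})$ bits of communication.
   Context: Setting (one-shot coordinator model): there are $k$ servers and a coordinator; each server communicates with the coordinator over a private two-way channel (no server-to-server communication). Each server $j\in[k]$ holds a vector $f(j)\in\mathbb{Z}_{\ge 0}^n$ and $f=\sum_{j\in[k]}f(j)$. Communication cost is the total number of bits exchanged. A perfect $L_p$ sampler is a (randomized) protocol at the end of which the coordinator outputs an index $\mathbf{i}^*\in[n]$ with $\Pr[\mathbf{i}^*=i]=\frac{f_i^p}{\|f\|_p^p}\pm n^{-C}$ for every $i\in[n]$, where $\|f\|_p^p=\sum_i f_i^p$ and $C>0$ is a constant. The lower bound is on the worst-case communication over inputs (the universe size $n$ may be taken as large as needed as a function of $k$). *)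

theory Defs
  imports "HOL-Probability.Probability"
begin

text \<open>
  Servers are numbered \<open>0, \<dots>, k - 1\<close> and coordinates \<open>0, \<dots>, n - 1\<close>. The protocol proceeds bit by bit.
  A transcript lists all bits exchanged so far, each with the channel (server number) it was sent
  on and its direction: \<open>Down\<close> from the coordinator to the server, \<open>Up\<close> from the server to the
  coordinator.
\<close>

datatype direction = Down | Up

type_synonym transcript = "(nat \<times> direction \<times> bool) list"

datatype action = Send nat bool | Receive nat | Output nat

text \<open>
  The coordinator has no input and sees all channels, so it acts on the whole transcript; it also
  does the scheduling. A bit sent by a server depends only on the vector held by that server and
  on the bits exchanged on its own channel.
\<close>

datatype protocol = Protocol
  (coordinator: "transcript \<Rightarrow> action")
  (server: "nat \<Rightarrow> (nat \<Rightarrow> nat) \<Rightarrow> (direction \<times> bool) list \<Rightarrow> bool")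

definition valid_protocol :: "nat \<Rightarrow> nat \<Rightarrow> protocol \<Rightarrow> bool" where
  "valid_protocol k n P \<longleftrightarrow>
     (\<forall>t. case coordinator P t of Send j b \<Rightarrow> j < k | Receive j \<Rightarrow> j < k | Output i \<Rightarrow> i < n)"

definition channel :: "nat \<Rightarrow> transcript \<Rightarrow> (direction \<times> bool) list" where
  "channel j t = map snd (filter (\<lambda>e. fst e = j) t)"

definition step :: "protocol \<Rightarrow> (nat \<Rightarrow> nat \<Rightarrow> nat) \<Rightarrow> transcript \<Rightarrow> transcript" where
  "step P x t = (case coordinator P t of
       Send j b \<Rightarrow> t @ [(j, Down, b)]
     | Receive j \<Rightarrow> t @ [(j, Up, server P j (x j) (channel j t))]
     | Output i \<Rightarrow> t)"

definition run :: "protocol \<Rightarrow> (nat \<Rightarrow> nat \<Rightarrow> nat) \<Rightarrow> nat \<Rightarrow> transcript" where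
  "run P x r = (step P x ^^ r) []"

definition outputs :: "protocol \<Rightarrow> (nat \<Rightarrow> nat \<Rightarrow> nat) \<Rightarrow> nat \<Rightarrow> bool" where
  "outputs P x i \<longleftrightarrow> (\<exists>r. coordinator P (run P x r) = Output i)"

text \<open>The number of bits exchanged; infinite if the protocol does not terminate.\<close>

definition bits :: "protocol \<Rightarrow> (nat \<Rightarrow> nat \<Rightarrow> nat) \<Rightarrow> enat" where
  "bits P x = (SUP r. enat (length (run P x r)))"

definition total_vector :: "nat \<Rightarrow> (nat \<Rightarrow> nat \<Rightarrow> nat) \<Rightarrow> nat \<Rightarrow> nat" where
  "total_vector k x i = (\<Sum>j<k. x j i)"

text \<open>
  \<open>x j i\<close> is entry \<open>i\<close> of the vector held by server \<open>j\<close>. The entries are bounded by \<open>m\<close>, where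
  \<open>m = \<infinity>\<close> stands for arbitrary natural numbers. (With \<open>m = \<infinity>\<close> alone a lower bound would say little: comparing
  unbounded magnitudes already takes unboundedly many bits.) Entries outside the index range are fixed to \<open>0\<close>,
  so that they carry no information. The sampling distribution is undefined if the sum vector is
  zero, so this case is excluded.
\<close>

definition inputs :: "nat \<Rightarrow> nat \<Rightarrow> enat \<Rightarrow> (nat \<Rightarrow> nat \<Rightarrow> nat) set" where
  "inputs k n m = {x. (\<forall>j i. enat (x j i) \<le> m) \<and> (\<forall>j i. j \<ge> k \<or> i \<ge> n \<longrightarrow> x j i = 0)
                    \<and> (\<exists>i<n. total_vector k x i \<noteq> 0)}"

text \<open>
  A randomized protocol is a probability distribution on deterministic protocols. The coordinator
  and the servers are drawn jointly, so both shared and private randomness are covered.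
\<close>

definition randomized_protocol :: "nat \<Rightarrow> nat \<Rightarrow> enat \<Rightarrow> protocol measure \<Rightarrow> bool" where
  "randomized_protocol k n m M \<longleftrightarrow>
     prob_space M \<and>
     (\<forall>P \<in> space M. valid_protocol k n P) \<and>
     (\<forall>x \<in> inputs k n m. \<forall>i. {P \<in> space M. outputs P x i} \<in> sets M)"

definition perfect_Lp_sampler ::
  "real \<Rightarrow> real \<Rightarrow> nat \<Rightarrow> nat \<Rightarrow> enat \<Rightarrow> protocol measure \<Rightarrow> bool" where
  "perfect_Lp_sampler p C k n m M \<longleftrightarrow>
     randomized_protocol k n m M \<and>
     (\<forall>x \<in> inputs k n m.
        (AE P in M. \<exists>i<n. outputs P x i) \<and>
        (\<forall>i<n. \<bar>\<P>(P in M. outputs P x i)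
                 - real (total_vector k x i) powr p / (\<Sum>l<n. real (total_vector k x l) powr p)\<bar>
               \<le> real n powr (- C)))"

text \<open>Worst case over inputs and over random choices, disregarding events of probability zero.\<close>

definition comm_cost :: "nat \<Rightarrow> nat \<Rightarrow> enat \<Rightarrow> protocol measure \<Rightarrow> enat" where
  "comm_cost k n m M = Inf {B. \<forall>x \<in> inputs k n m. AE P in M. bits P x \<le> B}"

end

theory Submission
  imports Defs
begin

text \<open>
  The bound \<open>\<Omega>(k)\<close>: let server \<open>0\<close> hold one unit vector and all others nothing. Giving one more server a
  different unit vector changes the output with probability about \<open>1/2\<close>, so that server must have been
  contacted with about that probability; sum over the servers.

  The bound \<open>\<Omega>(k\<^bsup>p-1\<^esup>)\<close> for \<open>p > 2\<close>: use \<open>s \<approx> k\<^bsup>p\<^esup>\<close> coordinates and let every server hold a random set that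
  contains each coordinate independently with probability \<open>1/k\<close>. Planting coordinate \<open>i\<close> means
  that each server in addition includes \<open>i\<close> with probability \<open>1/2\<close>. Then \<open>f\<^sub>i \<approx> k/2\<close> while the rest of
  \<open>\<parallel>f\<parallel>\<^sub>p\<^sup>p\<close> is \<open>O(s)\<close>, so a sampler outputs \<open>i\<close> with constant probability. On the other hand a deterministic protocol
  with \<open>B\<close> bits splits the inputs into at most \<open>2\<^sup>B\<close> rectangles. The relative entropy of the transcript
  without planting to the transcript with \<open>i\<close> planted is a sum over the servers, by
  the rectangle property. Since planting is only partial, the likelihood ratio of a server is at least \<open>1/2\<close>, and
  the relative entropy is at most \<open>k\<close> times the information that the transcript reveals about
  the memberships of \<open>i\<close>. By independence of the coordinates these contributions sum up to at most \<open>k B ln 2\<close>. Hence the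
  probabilities of outputting the planted coordinate sum up to \<open>O(k B + 1)\<close>, and \<open>B = \<Omega>(s/k)\<close>.
\<close>

section \<open>Deterministic protocols\<close>

lemma run_Suc: "run P x (Suc r) = step P x (run P x r)"
  by (simp add: run_def)

definition halted :: "protocol \<Rightarrow> transcript \<Rightarrow> bool" where
  "halted P t \<longleftrightarrow> (\<exists>i. coordinator P t = Output i)"

lemma step_halted: "halted P t \<Longrightarrow> step P x t = t"
  by (auto simp: halted_def step_def)

lemma step_not_halted: "\<not> halted P t \<Longrightarrow> \<exists>e. step P x t = t @ [e]"
  by (auto simp: halted_def step_def split: action.splits)

lemma step_cong:
  assumes "\<And>j. coordinator P t = Receive j \<Longrightarrow> x j = y j"
  shows "step P x t = step P y t"
  using assms by (auto simp: step_def split: action.splits)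

lemma run_add_halted: "halted P (run P x r) \<Longrightarrow> run P x (r + d) = run P x r"
  by (induction d) (auto simp: run_Suc step_halted)

lemma run_halted: "halted P (run P x r) \<Longrightarrow> r \<le> r' \<Longrightarrow> run P x r' = run P x r"
  using run_add_halted[of P x r "r' - r"] by simp

lemma length_run_not_halted: "\<not> halted P (run P x r) \<Longrightarrow> length (run P x r) = r"
proof (induction r)
  case 0
  then show ?case by (simp add: run_def)
next
  case (Suc r)
  then have "\<not> halted P (run P x r)"
    by (auto simp: run_Suc step_halted)
  with Suc.IH step_not_halted[OF this, of x] show ?case
    by (auto simp: run_Suc)
qed

lemma length_run_le: "length (run P x r) \<le> r"
proof (induction r)
  case (Suc r)
  then show ?case
    using step_halted[of P "run P x r" x] step_not_halted[of P "run P x r" x]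
    by (cases "halted P (run P x r)") (auto simp: run_Suc)
qed (simp add: run_def)

lemma run_eq_take: "r \<le> r' \<Longrightarrow> run P x r = take r (run P x r')"
proof (induction r' rule: dec_induct)
  case base
  then show ?case using length_run_le[of P x r] by simp
next
  case (step m)
  show ?case
  proof (cases "halted P (run P x m)")
    case True
    then show ?thesis using step by (simp add: run_Suc step_halted)
  next
    case False
    then show ?thesis
      using step step_not_halted[OF False, of x] length_run_not_halted[OF False]
      by (auto simp: run_Suc)
  qed
qed

text \<open>Each step before halting exchanges exactly one bit, so a run still active after
  \<open>B\<close> steps would reach \<open>B + 1\<close> bits.\<close>

lemma halted_if_bits_le:
  assumes "bits P x \<le> enat B"
  shows "halted P (run P x B)"
proof (rule ccontr)
  assume n: "\<not> halted P (run P x B)"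
  have "enat (length (run P x (Suc B))) \<le> bits P x"
    unfolding bits_def by (rule SUP_upper) simp
  with assms have "length (run P x (Suc B)) \<le> B"
    by (meson enat_ord_simps(1) order_trans)
  moreover have "length (run P x (Suc B)) = Suc B"
    using step_not_halted[OF n, of x] length_run_not_halted[OF n] by (auto simp: run_Suc)
  ultimately show False by simp
qed

lemma outputs_iff:
  assumes "bits P x \<le> enat B"
  shows "outputs P x i \<longleftrightarrow> coordinator P (run P x B) = Output i"
proof
  assume "outputs P x i"
  then obtain r where r: "coordinator P (run P x r) = Output i"
    by (auto simp: outputs_def)
  have "run P x B = run P x r"
  proof (cases "r \<le> B")
    case True
    then show ?thesis using r run_halted[of P x r B] by (auto simp: halted_def)
  next
    case False
    then show ?thesis using run_halted[OF halted_if_bits_le[OF assms], of r] by simp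
  qed
  with r show "coordinator P (run P x B) = Output i" by simp
qed (auto simp: outputs_def)

text \<open>The common prefix determines the next action, and a bit sent by server \<open>j\<close>
  depends only on the prefix and on \<open>x j\<close>; so each step can be copied from the witness
  for that server.\<close>

lemma run_rectangle:
  assumes "valid_protocol k n P" and "k > 0"
    and ex: "\<And>j. j < k \<Longrightarrow> \<exists>y. run P y B = t \<and> y j = x j"
  shows "run P x B = t"
proof -
  from ex obtain y where y: "\<And>j. j < k \<Longrightarrow> run P (y j) B = t" "\<And>j. j < k \<Longrightarrow> y j j = x j"
    by metis
  have yr: "run P (y j) r = take r t" if "j < k" "r \<le> B" for j r
    using run_eq_take[OF that(2), of P "y j"] y(1)[OF that(1)] by simp
  have "run P x r = take r t" if "r \<le> B" for r
    using that
  proof (induction r)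
    case (Suc r)
    then have IH: "run P x r = take r t" by simp
    \<comment> \<open>\<open>l\<close> is the server whose witness is followed in this step; any
      server will do unless a bit is received.\<close>
    obtain l where l: "l < k" "\<And>j. coordinator P (take r t) = Receive j \<Longrightarrow> l = j"
    proof (cases "coordinator P (take r t)")
      case (Receive j)
      then have "j < k" using assms(1) by (auto simp: valid_protocol_def split: action.splits)
      then show thesis using that Receive by auto
    qed (use that \<open>k > 0\<close> in auto)
    have "run P x (Suc r) = step P (y l) (take r t)"
      unfolding run_Suc IH by (rule step_cong) (use l y(2) in auto)
    also have "\<dots> = run P (y l) (Suc r)"
      using yr[OF l(1), of r] Suc.prems by (simp add: run_Suc)
    finally show ?case using yr[OF l(1) Suc.prems] by simp
  qed (simp add: run_def)
  from this[of B] show ?thesis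
    using yr[of 0 B] y(1)[of 0] \<open>k > 0\<close> by simp
qed

text \<open>A vector influences a run only through bits sent by its holder, and each such bit leaves
  the holder's number in the transcript.\<close>

lemma run_cong_uncontacted:
  assumes "\<And>l. l \<noteq> j \<Longrightarrow> y l = x l" and nin: "j \<notin> fst ` set (run P x B)"
  shows "run P y B = run P x B"
proof -
  have "run P y r = run P x r" if "r \<le> B" for r
    using that
  proof (induction r)
    case (Suc r)
    then have IH: "run P y r = run P x r" by simp
    have "step P y (run P x r) = step P x (run P x r)"
    proof (rule step_cong)
      fix l assume l: "coordinator P (run P x r) = Receive l"
      then have "l \<in> fst ` set (run P x (Suc r))"
        by (simp add: run_Suc step_def)
      also have "\<dots> \<subseteq> fst ` set (run P x B)"
        using run_eq_take[OF Suc.prems, of P x] set_take_subset by (metis image_mono)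
      finally show "y l = x l" using nin assms(1) by metis
    qed
    then show ?case by (simp add: run_Suc IH)
  qed (simp add: run_def)
  then show ?thesis by simp
qed

lemma card_runs_le: "finite ((\<lambda>x. run P x r) ` X) \<and> card ((\<lambda>x. run P x r) ` X) \<le> 2 ^ r"
proof (induction r)
  case 0
  have "(\<lambda>x. run P x 0) ` X \<subseteq> {[]}" by (auto simp: run_def)
  then show ?case
    using card_mono[of "{[]}" "(\<lambda>x. run P x 0) ` X"] by (auto dest: finite_subset)
next
  case (Suc r)
  \<comment> \<open>In \<open>f b t\<close> a received bit has the value \<open>b\<close>. Nothing
    else in a step depends on the input, so the number of transcripts at most doubles.\<close>
  define f where "f b t = (case coordinator P t of
       Send j c \<Rightarrow> t @ [(j, Down, c)] | Receive j \<Rightarrow> t @ [(j, Up, b)] | Output i \<Rightarrow> t)" for b t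
  let ?R = "\<lambda>r. (\<lambda>x. run P x r) ` X"
  have "step P x t \<in> {f True t, f False t}" for x t
    by (cases "coordinator P t") (auto simp: step_def f_def intro: bool.exhaust)
  then have sub: "?R (Suc r) \<subseteq> f True ` ?R r \<union> f False ` ?R r"
    by (fastforce simp: run_Suc)
  have "card (f True ` ?R r \<union> f False ` ?R r) \<le> card (?R r) + card (?R r)"
    using Suc by (intro order_trans[OF card_Un_le] add_mono card_image_le) auto
  also have "\<dots> \<le> 2 ^ Suc r" using Suc by simp
  finally show ?case
    using Suc sub by (meson card_mono finite_UnI finite_imageI finite_subset order_trans)
qed

text \<open>Linearity of expectation transfers a bound for almost every deterministic protocol to
  probabilities. The coefficients may be negative.\<close>

lemma (in prob_space) sum_prob_le_if_AE:
  assumes fin: "finite Y" and ev: "\<And>y. y \<in> Y \<Longrightarrow> E y \<in> events"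
    and AE: "AE \<omega> in M. (\<Sum>y\<in>Y. c y * indicator (E y) \<omega>) \<le> V"
  shows "(\<Sum>y\<in>Y. c y * prob (E y)) \<le> (V :: real)"
proof -
  have int: "integrable M (\<lambda>\<omega>. c y * indicator (E y) \<omega> :: real)" if "y \<in> Y" for y
    using ev[OF that] by (intro integrable_mult_right integrable_real_indicator) (auto simp: less_top[symmetric])
  have "(\<Sum>y\<in>Y. c y * prob (E y)) = (\<integral>\<omega>. (\<Sum>y\<in>Y. c y * indicator (E y) \<omega>) \<partial>M)"
    using int ev by (subst Bochner_Integration.integral_sum) (auto intro!: sum.cong)
  also have "\<dots> \<le> (\<integral>\<omega>. V \<partial>M)"
    using int AE by (intro integral_mono_AE Bochner_Integration.integrable_sum) auto
  finally show ?thesis by (simp add: prob_space)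
qed

section \<open>Information about independent memberships\<close>

text \<open>Both sides vanish to second order at \<open>r = 1\<close>, and
  \<open>(sqrt r - 1)\<^sup>2\<close> separates them. The left side will be a relative entropy term
  with a correction of mean zero, the right side an information term.\<close>

lemma neg_ln_half_one_plus_le:
  fixes r :: real
  assumes "r \<ge> 0"
  shows "- ln ((1 + r) / 2) + (r - 1) / 2 \<le> r * ln r - r + 1"
proof -
  have "ln (2 / (1 + r)) \<le> 2 / (1 + r) - 1"
    using assms by (intro ln_le_minus_one) auto
  moreover have "ln (2 / (1 + r)) = - ln ((1 + r) / 2)"
    using assms by (simp add: ln_div)
  ultimately have "- ln ((1 + r) / 2) + (r - 1) / 2 \<le> 2 / (1 + r) - 1 + (r - 1) / 2"
    by simp
  also have "\<dots> = (r - 1)\<^sup>2 / (2 * (1 + r))"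
    using assms by (simp add: field_simps power2_eq_square)
  also have "\<dots> \<le> (sqrt r - 1)\<^sup>2"
  proof -
    have "(r - 1)\<^sup>2 = ((sqrt r - 1) * (sqrt r + 1))\<^sup>2"
      using assms by (simp add: algebra_simps)
    also have "\<dots> = (sqrt r - 1)\<^sup>2 * (sqrt r + 1)\<^sup>2"
      by (simp add: power_mult_distrib)
    also have "\<dots> \<le> (sqrt r - 1)\<^sup>2 * (2 * (1 + r))"
    proof (rule mult_left_mono)
      have "0 \<le> (sqrt r - 1)\<^sup>2" by simp
      then show "(sqrt r + 1)\<^sup>2 \<le> 2 * (1 + r)"
        using assms by (simp add: power2_eq_square algebra_simps)
    qed simp
    finally show ?thesis using assms by (simp add: divide_le_eq)
  qed
  also have "\<dots> = r - 2 * sqrt r + 1"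
    using assms by (simp add: power2_eq_square algebra_simps)
  also have "\<dots> \<le> r * ln r - r + 1"
  proof (cases "r = 0")
    case False
    with assms have r: "r > 0" by simp
    have "ln (1 / sqrt r) \<le> 1 / sqrt r - 1"
      using r by (intro ln_le_minus_one) auto
    then have "- ln r / 2 \<le> 1 / sqrt r - 1"
      using r by (simp add: ln_div ln_sqrt)
    then have "2 * r * (- ln r / 2) \<le> 2 * r * (1 / sqrt r - 1)"
      using r by (intro mult_left_mono) auto
    moreover have "2 * r * (1 / sqrt r - 1) = 2 * (r / sqrt r) - 2 * r"
      by (simp add: right_diff_distrib)
    ultimately show ?thesis
      using r by (simp add: real_div_sqrt)
  qed simp
  finally show ?thesis .
qed

section \<open>Random sets with independent memberships\<close>

definition bernoulli_weight :: "nat \<Rightarrow> (nat \<Rightarrow> real) \<Rightarrow> nat set \<Rightarrow> real" where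
  "bernoulli_weight s b C = (\<Prod>e\<in>C. b e) * (\<Prod>e\<in>{..<s} - C. 1 - b e)"

text \<open>Generating function of a random set that contains each \<open>e\<close> independently
  with probability \<open>b e\<close>: expanding the product chooses membership or absence for each
  \<open>e\<close>.\<close>

lemma sum_bernoulli_weight_prod:
  "(\<Sum>C\<in>Pow {..<s}. bernoulli_weight s b C * (\<Prod>e\<in>C. h e)) = (\<Prod>e<s. 1 - b e + b e * h e)"
proof -
  have "(\<Prod>e<s. b e * h e + (1 - b e))
      = (\<Sum>C\<in>Pow {..<s}. (\<Prod>e\<in>C. b e * h e) * (\<Prod>e\<in>{..<s} - C. 1 - b e))"
    by (rule prod_add) simp
  then show ?thesis
    by (simp add: bernoulli_weight_def prod.distrib algebra_simps)
qed

lemma sum_bernoulli_weight_single: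
  assumes "i < s"
  shows "(\<Sum>C\<in>Pow {..<s}. bernoulli_weight s b C * (if i \<in> C then y else 1)) = 1 - b i + b i * y"
proof -
  have "(\<Sum>C\<in>Pow {..<s}. bernoulli_weight s b C * (if i \<in> C then y else 1))
      = (\<Sum>C\<in>Pow {..<s}. bernoulli_weight s b C * (\<Prod>e\<in>C. if e = i then y else 1))"
    by (intro sum.cong refl) (auto simp: finite_subset)
  also have "\<dots> = (\<Prod>e<s. if e = i then 1 - b i + b i * y else 1)"
    unfolding sum_bernoulli_weight_prod by (intro prod.cong) auto
  finally show ?thesis using assms by simp
qed

lemma sum_bernoulli_weight: "(\<Sum>C\<in>Pow {..<s}. bernoulli_weight s b C) = 1"
  using sum_bernoulli_weight_prod[of s b "\<lambda>_. 1"] by simp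

lemma sum_bernoulli_weight_member:
  assumes "i < s"
  shows "(\<Sum>C\<in>Pow {..<s}. bernoulli_weight s b C * of_bool (i \<in> C)) = b i"
proof -
  have "bernoulli_weight s b C * of_bool (i \<in> C)
      = bernoulli_weight s b C - bernoulli_weight s b C * (if i \<in> C then 0 else 1)" for C
    by simp
  then show ?thesis
    using sum_bernoulli_weight_single[OF assms, of b 0] sum_bernoulli_weight[of s b]
    by (simp add: sum_subtractf)
qed

lemma bernoulli_weight_pos:
  assumes "\<And>e. 0 < b e" "\<And>e. b e < 1"
  shows "bernoulli_weight s b C > 0"
  using assms by (auto simp: bernoulli_weight_def intro!: mult_pos_pos prod_pos)

text \<open>
  Here \<open>\<rho> i\<close> is the factor by which conditioning on \<open>S\<close> changes the probability of \<open>i\<close>. The proof is the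
  Gibbs variational inequality for the test function \<open>\<Prod>i\<in>C. \<rho> i\<close>.
\<close>

lemma bernoulli_information:
  fixes a :: real and s :: nat
  defines "\<nu> \<equiv> bernoulli_weight s (\<lambda>_. a)"
  assumes a: "0 < a" "a < 1" and S: "S \<subseteq> Pow {..<s}" "S \<noteq> {}"
    and \<rho>: "\<And>i. \<rho> i = (\<Sum>C\<in>S. \<nu> C * of_bool (i \<in> C)) / (a * (\<Sum>C\<in>S. \<nu> C))"
  shows "(\<Sum>i<s. \<rho> i * ln (\<rho> i) - \<rho> i + 1) \<le> - ln (\<Sum>C\<in>S. \<nu> C) / a"
proof -
  define N where "N = (\<Sum>C\<in>S. \<nu> C)"
  \<comment> \<open>\<open>exp E\<close> bounds the total mass of the test function
    \<open>G\<close>; \<open>E\<close> also supplies the terms \<open>- \<rho> i + 1\<close> of the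
    claim.\<close>
  define E where "E = (\<Sum>i<s. a * (\<rho> i - 1))"
  define G where "G C = (\<Prod>i\<in>C. \<rho> i)" for C
  have \<nu>: "\<nu> C > 0" for C
    unfolding \<nu>_def using a by (intro bernoulli_weight_pos) auto
  have fS: "finite S" using S(1) finite_subset by auto
  have N: "N > 0" unfolding N_def using \<nu> S fS by (intro sum_pos) auto
  have \<rho>N: "(\<Sum>C\<in>S. \<nu> C * of_bool (i \<in> C)) = a * N * \<rho> i" for i
    using N a by (simp add: \<rho> N_def)
  have \<rho>0: "\<rho> i \<ge> 0" for i
    unfolding \<rho> using a N \<nu> by (intro divide_nonneg_nonneg sum_nonneg mult_nonneg_nonneg)
      (auto simp: N_def less_imp_le)
  have \<rho>pos: "\<rho> i > 0" if "C \<in> S" "i \<in> C" for i C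
  proof -
    have "0 < \<nu> C * of_bool (i \<in> C)" using \<nu> that by simp
    also have "\<dots> \<le> a * N * \<rho> i"
      unfolding \<rho>N[symmetric] using fS that \<nu>
      by (intro member_le_sum) (auto simp: less_imp_le)
    finally show ?thesis using \<rho>0[of i] a N by (simp add: zero_less_mult_iff)
  qed
  have G: "G C > 0" if "C \<in> S" for C
    unfolding G_def using \<rho>pos[OF that] by (intro prod_pos) auto
  have lnG: "ln (G C) = (\<Sum>i<s. of_bool (i \<in> C) * ln (\<rho> i))" if "C \<in> S" for C
  proof -
    have C: "C \<subseteq> {..<s}" "finite C" using that S finite_subset by auto
    have "ln (G C) = (\<Sum>i\<in>C. ln (\<rho> i))"
      unfolding G_def using C \<rho>pos[OF that] by (intro ln_prod) force+
    also have "\<dots> = (\<Sum>i<s. of_bool (i \<in> C) * ln (\<rho> i))"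
      using C by (intro sum.mono_neutral_cong_left) auto
    finally show ?thesis .
  qed
  have sumlnG: "(\<Sum>C\<in>S. \<nu> C * ln (G C)) = N * (\<Sum>i<s. a * (\<rho> i * ln (\<rho> i)))"
  proof -
    have "(\<Sum>C\<in>S. \<nu> C * ln (G C)) = (\<Sum>C\<in>S. \<Sum>i<s. \<nu> C * of_bool (i \<in> C) * ln (\<rho> i))"
      by (intro sum.cong refl) (simp only: lnG sum_distrib_left mult.assoc)
    also have "\<dots> = (\<Sum>i<s. (\<Sum>C\<in>S. \<nu> C * of_bool (i \<in> C)) * ln (\<rho> i))"
      by (subst sum.swap) (simp add: sum_distrib_right)
    also have "\<dots> = N * (\<Sum>i<s. a * (\<rho> i * ln (\<rho> i)))"
      unfolding \<rho>N by (simp add: sum_distrib_left algebra_simps)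
    finally show ?thesis .
  qed
  have sumG: "(\<Sum>C\<in>S. \<nu> C * G C) \<le> exp E"
  proof -
    have "(\<Sum>C\<in>S. \<nu> C * G C) \<le> (\<Sum>C\<in>Pow {..<s}. \<nu> C * G C)"
      using S \<nu> \<rho>0 by (intro sum_mono2) (auto simp: G_def less_imp_le intro!: mult_nonneg_nonneg prod_nonneg)
    also have "\<dots> = (\<Prod>i<s. 1 - a + a * \<rho> i)"
      unfolding G_def \<nu>_def by (rule sum_bernoulli_weight_prod)
    also have "\<dots> \<le> (\<Prod>i<s. exp (a * (\<rho> i - 1)))"
    proof (rule prod_mono, intro conjI)
      fix i
      show "0 \<le> 1 - a + a * \<rho> i" using a \<rho>0[of i] by simp
      show "1 - a + a * \<rho> i \<le> exp (a * (\<rho> i - 1))"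
        using exp_ge_add_one_self[of "a * (\<rho> i - 1)"] by (simp add: algebra_simps)
    qed
    also have "\<dots> = exp E" unfolding E_def by (simp add: exp_sum)
    finally show ?thesis .
  qed
  \<comment> \<open>Jensen's inequality in the form \<open>ln x \<le> x - 1\<close>, where
    \<open>x = G C * N * exp (- E)\<close> has conditional mean at most 1 on \<open>S\<close> by
    \<open>sumG\<close>.\<close>
  have "N * ((\<Sum>i<s. a * (\<rho> i * ln (\<rho> i))) + ln N - E) = (\<Sum>C\<in>S. \<nu> C * (ln (G C) + ln N - E))"
    unfolding ring_distribs right_diff_distrib sum.distrib sum_subtractf sumlnG
    by (simp add: N_def sum_distrib_right)
  also have "\<dots> \<le> (\<Sum>C\<in>S. \<nu> C * (G C * N * exp (- E) - 1))"
  proof (intro sum_mono mult_left_mono)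
    fix C assume C: "C \<in> S"
    have "ln (G C * N * exp (- E)) \<le> G C * N * exp (- E) - 1"
      using G[OF C] N by (intro ln_le_minus_one) auto
    moreover have "ln (G C * N * exp (- E)) = ln (G C) + ln N - E"
      using G[OF C] N by (simp add: ln_mult)
    ultimately show "ln (G C) + ln N - E \<le> G C * N * exp (- E) - 1" by simp
  qed (use \<nu> in \<open>auto simp: less_imp_le\<close>)
  also have "\<dots> = N * exp (- E) * (\<Sum>C\<in>S. \<nu> C * G C) - N"
    by (simp add: right_diff_distrib sum_subtractf sum_distrib_left algebra_simps flip: N_def)
  also have "\<dots> \<le> N * exp (- E) * exp E - N"
    using sumG N by (intro diff_right_mono mult_left_mono) auto
  also have "\<dots> = 0" by (simp add: exp_minus)
  finally have "(\<Sum>i<s. a * (\<rho> i * ln (\<rho> i))) + ln N - E \<le> 0"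
    using N by (simp add: mult_le_0_iff)
  then have "a * (\<Sum>i<s. \<rho> i * ln (\<rho> i) - \<rho> i + 1) \<le> - ln N"
    unfolding E_def by (simp add: sum_distrib_left sum_subtractf sum.distrib algebra_simps)
  then show ?thesis
    using a by (simp add: N_def field_simps)
qed

text \<open>Rows stay independent on a product set, so a function of row \<open>l\<close> is
  averaged over the conditional law of that row alone.\<close>

lemma sum_PiE_marginal:
  fixes \<mu> u :: "'a \<Rightarrow> real" and k :: nat
  assumes fin: "\<And>l. l < k \<Longrightarrow> finite (S l)" and l: "l < k" and "(\<Sum>C\<in>S l. \<mu> C) \<noteq> 0"
  shows "(\<Sum>g\<in>PiE {..<k} S. (\<Prod>j<k. \<mu> (g j)) * u (g l))
       = (\<Prod>j<k. \<Sum>C\<in>S j. \<mu> C) * ((\<Sum>C\<in>S l. \<mu> C * u C) / (\<Sum>C\<in>S l. \<mu> C))"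
proof -
  let ?f = "\<lambda>j C. \<mu> C * (if j = l then u C else 1)"
  have "(\<Sum>g\<in>PiE {..<k} S. (\<Prod>j<k. \<mu> (g j)) * u (g l)) = (\<Sum>g\<in>PiE {..<k} S. \<Prod>j<k. ?f j (g j))"
    using l by (simp add: prod.distrib)
  also have "\<dots> = (\<Prod>j<k. \<Sum>C\<in>S j. ?f j C)"
    using fin by (subst prod_sum_PiE) auto
  also have "\<dots> = (\<Prod>j<k. (\<Sum>C\<in>S j. \<mu> C) *
      (if j = l then (\<Sum>C\<in>S l. \<mu> C * u C) / (\<Sum>C\<in>S l. \<mu> C) else 1))"
    using assms(3) by (intro prod.cong) auto
  finally show ?thesis using l by (simp add: prod.distrib)
qed

text \<open>Gibbs' inequality against the uniform distribution on \<open>A\<close>.\<close>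

lemma entropy_le_ln_card:
  fixes W :: "'a \<Rightarrow> real"
  assumes "finite A" and "A \<noteq> {}" and W: "\<And>t. t \<in> A \<Longrightarrow> W t > 0" and "sum W A = 1"
  shows "(\<Sum>t\<in>A. W t * - ln (W t)) \<le> ln (card A)"
proof -
  have c: "card A > 0" using assms by (simp add: card_gt_0_iff)
  have "(\<Sum>t\<in>A. W t * - ln (W t)) - ln (card A) = (\<Sum>t\<in>A. W t * (- ln (W t) - ln (card A)))"
    unfolding right_diff_distrib sum_subtractf by (simp add: assms(4) flip: sum_distrib_right)
  also have "\<dots> \<le> (\<Sum>t\<in>A. 1 / card A - W t)"
  proof (rule sum_mono)
    fix t assume t: "t \<in> A"
    have "ln (1 / (W t * card A)) \<le> 1 / (W t * card A) - 1"
      using W[OF t] c by (intro ln_le_minus_one) auto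
    then have "W t * (- ln (W t) - ln (card A)) \<le> W t * (1 / (W t * card A) - 1)"
      using W[OF t] c by (intro mult_left_mono) (auto simp: ln_div ln_mult)
    also have "\<dots> = 1 / card A - W t"
      using W[OF t] c by (simp add: field_simps)
    finally show "W t * (- ln (W t) - ln (card A)) \<le> 1 / card A - W t" .
  qed
  also have "\<dots> = 0" using c by (simp add: sum_subtractf assms(4))
  finally show ?thesis by simp
qed

section \<open>The planted distribution and its relative entropy\<close>

definition assignments :: "nat \<Rightarrow> nat \<Rightarrow> (nat \<Rightarrow> nat set) set" where
  "assignments k s = PiE {..<k} (\<lambda>_. Pow {..<s})"

lemma finite_assignments: "finite (assignments k s)"
  by (simp add: assignments_def finite_PiE)

text \<open>With density \<open>1 / k\<close> an unplanted coordinate has one holder on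
  average.\<close>

definition row_weight :: "nat \<Rightarrow> nat \<Rightarrow> nat set \<Rightarrow> real" where
  "row_weight k s = bernoulli_weight s (\<lambda>_. 1 / k)"

text \<open>
  The factor is the likelihood ratio of the half-half mixture of the base distribution and the one
  conditioned on \<open>i \<in> C\<close>. It never vanishes, which keeps the relative entropies below finite.
\<close>

definition planted_row :: "nat \<Rightarrow> nat \<Rightarrow> nat \<Rightarrow> nat set \<Rightarrow> real" where
  "planted_row k s i C = row_weight k s C * ((1 + k * of_bool (i \<in> C)) / 2)"

definition planted_weight :: "nat \<Rightarrow> nat \<Rightarrow> nat \<Rightarrow> (nat \<Rightarrow> nat set) \<Rightarrow> real" where
  "planted_weight k s i g = (\<Prod>l<k. planted_row k s i (g l))"

text \<open>The likelihood ratio is \<open>(1 + k) / 2\<close> if \<open>i\<close> is present and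
  \<open>1 / 2\<close> otherwise; so memberships stay independent and only the probability of
  \<open>i\<close> changes.\<close>

lemma planted_row_eq:
  assumes "k > 1" "i < s" "C \<subseteq> {..<s}"
  shows "planted_row k s i C = bernoulli_weight s (\<lambda>e. if e = i then (1 + 1 / k) / 2 else 1 / k) C"
proof -
  let ?a = "1 / real k"
  have "finite C" using assms(3) finite_subset by blast
  have 1: "(\<Prod>e\<in>C. if e = i then (1 + ?a) / 2 else ?a)
      = (\<Prod>e\<in>C. ?a * (if e = i then (1 + k) / 2 else 1))"
    using assms by (intro prod.cong) (auto simp: field_simps)
  have 2: "(\<Prod>e\<in>{..<s} - C. 1 - (if e = i then (1 + ?a) / 2 else ?a))
      = (\<Prod>e\<in>{..<s} - C. (1 - ?a) * (if e = i then 1 / 2 else 1))"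
    using assms by (intro prod.cong) (auto simp: field_simps)
  show ?thesis
    unfolding planted_row_def row_weight_def bernoulli_weight_def 1 2
    using assms \<open>finite C\<close> by (simp only: prod.distrib) auto
qed

lemma sum_planted_row:
  assumes "k > 1" "i < s"
  shows "(\<Sum>C\<in>Pow {..<s}. planted_row k s i C) = 1"
  using planted_row_eq[OF assms] by (simp add: sum_bernoulli_weight)

lemma sum_planted_weight:
  assumes "k > 1" "i < s"
  shows "(\<Sum>g\<in>assignments k s. planted_weight k s i g) = 1"
proof -
  have "(\<Sum>g\<in>assignments k s. planted_weight k s i g) = (\<Prod>l<k. \<Sum>C\<in>Pow {..<s}. planted_row k s i C)"
    unfolding planted_weight_def assignments_def by (subst prod_sum_PiE) auto
  then show ?thesis by (simp add: sum_planted_row[OF assms])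
qed

lemma planted_weight_nonneg:
  assumes "k > 1"
  shows "planted_weight k s i g \<ge> 0"
proof -
  have "row_weight k s C > 0" for C
    unfolding row_weight_def using assms by (intro bernoulli_weight_pos) auto
  then show ?thesis
    unfolding planted_weight_def planted_row_def
    by (intro prod_nonneg mult_nonneg_nonneg ballI) (auto simp: less_imp_le)
qed

text \<open>Transcript classes are product sets, so planted and unplanted masses factor over the
  servers. The chance of naming the planted \<open>i\<close> is at most twice a relative entropy
  plus the unplanted chance of naming \<open>i\<close>. Over all \<open>i\<close>, the former sum to
  at most \<open>k\<close> times the transcript entropy, the latter to at most 1.\<close>

lemma sum_planted_hits_le:
  fixes T :: "(nat \<Rightarrow> nat set) \<Rightarrow> 't" and out :: "'t \<Rightarrow> nat"
  assumes k: "k > 1"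
    and rect: "\<And>t g. g \<in> assignments k s \<Longrightarrow>
      (\<And>l. l < k \<Longrightarrow> \<exists>g'\<in>assignments k s. T g' = t \<and> g' l = g l) \<Longrightarrow> T g = t"
  shows "(\<Sum>i<s. \<Sum>g\<in>assignments k s. planted_weight k s i g * of_bool (out (T g) = i))
       \<le> 2 * (k * ln (card (T ` assignments k s)) + 1)"
proof -
  define X where "X = assignments k s"
  define \<nu> where "\<nu> = row_weight k s"
  define \<Theta> where "\<Theta> = T ` X"
  define R where "R t = {g \<in> X. T g = t}" for t
  define S where "S t l = (\<lambda>g. g l) ` R t" for t and l :: nat
  define N where "N t l = (\<Sum>C\<in>S t l. \<nu> C)" for t l
  \<comment> \<open>\<open>\<rho> t l i\<close> is the factor by which transcript \<open>t\<close>
    changes the probability that server \<open>l\<close> holds \<open>i\<close>. Below,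
    \<open>W t\<close> and \<open>V i t\<close> are the probabilities of \<open>t\<close> without
    planting and with \<open>i\<close> planted, \<open>\<eta> i\<close> and \<open>\<tau> i\<close>
    those of output \<open>i\<close>, and \<open>K i\<close> is the relative entropy of
    \<open>W\<close> to \<open>V i\<close>.\<close>
  define \<rho> where "\<rho> t l i = (\<Sum>C\<in>S t l. \<nu> C * of_bool (i \<in> C)) / (1 / k * N t l)" for t l i
  define w where "w g = (\<Prod>l<k. \<nu> (g l))" for g
  define W where "W t = (\<Sum>g\<in>R t. w g)" for t
  define V where "V i t = (\<Sum>g\<in>R t. planted_weight k s i g)" for i t
  define \<tau> where "\<tau> i = (\<Sum>t\<in>\<Theta>. V i t * of_bool (out t = i))" for i
  define \<eta> where "\<eta> i = (\<Sum>t\<in>\<Theta>. W t * of_bool (out t = i))" for i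
  define K where "K i = (\<Sum>t\<in>\<Theta>. W t * (\<Sum>l<k. - ln ((1 + \<rho> t l i) / 2)))" for i
  have fX: "finite X" unfolding X_def by (rule finite_assignments)
  have f\<Theta>: "finite \<Theta>" unfolding \<Theta>_def using fX by simp
  have fR: "finite (R t)" for t unfolding R_def using fX by simp
  have fS: "finite (S t l)" for t l unfolding S_def using fR by simp
  have \<nu>: "\<nu> C > 0" for C
    unfolding \<nu>_def row_weight_def using k by (intro bernoulli_weight_pos) auto
  have S: "S t l \<subseteq> Pow {..<s}" "S t l \<noteq> {}" if "t \<in> \<Theta>" "l < k" for t l
    using that by (auto simp: S_def R_def X_def assignments_def \<Theta>_def PiE_iff)
  have N: "N t l > 0" if "t \<in> \<Theta>" "l < k" for t l
    unfolding N_def using S[OF that] fS \<nu> by (intro sum_pos) auto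
  have \<rho>0: "\<rho> t l i \<ge> 0" if "t \<in> \<Theta>" "l < k" for t l i
    unfolding \<rho>_def using N[OF that] \<nu>
    by (intro divide_nonneg_nonneg sum_nonneg mult_nonneg_nonneg) (auto simp: less_imp_le)
  \<comment> \<open>This is where the rectangle hypothesis enters.\<close>
  have R: "R t = PiE {..<k} (S t)" if t: "t \<in> \<Theta>" for t
  proof (intro equalityI subsetI)
    fix g assume "g \<in> R t"
    then show "g \<in> PiE {..<k} (S t)"
      by (auto simp: S_def R_def X_def assignments_def PiE_iff)
  next
    fix g assume g: "g \<in> PiE {..<k} (S t)"
    then have gX: "g \<in> X"
      using S[OF t] unfolding X_def assignments_def PiE_iff by blast
    moreover have "T g = t"
    proof (rule rect)
      show "g \<in> assignments k s" using gX by (simp add: X_def)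
      fix l assume "l < k"
      then have "g l \<in> S t l" using g by (auto simp: PiE_iff)
      then show "\<exists>g'\<in>assignments k s. T g' = t \<and> g' l = g l"
        unfolding S_def R_def X_def by force
    qed
    ultimately show "g \<in> R t" by (simp add: R_def)
  qed
  have W: "W t = (\<Prod>l<k. N t l)" if "t \<in> \<Theta>" for t
    unfolding W_def R[OF that] w_def N_def using fS by (subst prod_sum_PiE) auto
  have Wpos: "W t > 0" if "t \<in> \<Theta>" for t
    unfolding W[OF that] using N[OF that] by (intro prod_pos) auto
  have V: "V i t = W t * (\<Prod>l<k. (1 + \<rho> t l i) / 2)" if t: "t \<in> \<Theta>" for t i
  proof -
    have "V i t = (\<Prod>l<k. \<Sum>C\<in>S t l. planted_row k s i C)"
      unfolding V_def R[OF t] planted_weight_def using fS by (subst prod_sum_PiE) auto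
    also have "\<dots> = (\<Prod>l<k. N t l * ((1 + \<rho> t l i) / 2))"
    proof (rule prod.cong)
      fix l assume "l \<in> {..<k}"
      then have l: "l < k" by simp
      have "(\<Sum>C\<in>S t l. planted_row k s i C) = (N t l + k * (\<Sum>C\<in>S t l. \<nu> C * of_bool (i \<in> C))) / 2"
        unfolding planted_row_def N_def \<nu>_def
        by (simp add: sum_distrib_left sum.distrib sum_divide_distrib algebra_simps add_divide_distrib)
      also have "\<dots> = N t l * ((1 + \<rho> t l i) / 2)"
        unfolding \<rho>_def using N[OF t l] k by (simp add: field_simps)
      finally show "(\<Sum>C\<in>S t l. planted_row k s i C) = N t l * ((1 + \<rho> t l i) / 2)" .
    qed simp
    finally show ?thesis unfolding W[OF t] by (simp only: prod.distrib)
  qed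
  have group: "(\<Sum>t\<in>\<Theta>. \<Sum>g\<in>R t. h g) = (\<Sum>g\<in>X. h g)" for h :: "_ \<Rightarrow> real"
    unfolding R_def by (rule sum.group) (use fX f\<Theta> in \<open>auto simp: \<Theta>_def\<close>)
  have sumW: "(\<Sum>t\<in>\<Theta>. W t) = 1"
  proof -
    have "(\<Sum>t\<in>\<Theta>. W t) = (\<Prod>l<k. \<Sum>C\<in>Pow {..<s}. \<nu> C)"
      unfolding W_def group w_def X_def assignments_def by (subst prod_sum_PiE) auto
    then show ?thesis by (simp add: \<nu>_def row_weight_def sum_bernoulli_weight)
  qed
  have sumV: "(\<Sum>t\<in>\<Theta>. V i t) = 1" if "i < s" for i
    unfolding V_def group using sum_planted_weight[OF k that] by (simp add: X_def)
  have \<tau>: "(\<Sum>g\<in>X. planted_weight k s i g * of_bool (out (T g) = i)) = \<tau> i" for i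
    unfolding \<tau>_def V_def group[symmetric] sum_distrib_right
    by (intro sum.cong refl) (auto simp: R_def)
  have \<tau>_le: "\<tau> i \<le> 2 * (K i + \<eta> i)" if "i < s" for i
  proof -
    \<comment> \<open>The differences \<open>W t - V i t\<close> sum to zero; including them makes
      the bound by \<open>K i\<close> hold for each transcript separately.\<close>
    have "\<tau> i / 2 - \<eta> i = (\<Sum>t\<in>\<Theta>. W t - V i t + of_bool (out t = i) * (V i t / 2 - W t))"
      using sumW sumV[OF that]
      by (simp add: sum.distrib sum_subtractf \<tau>_def \<eta>_def sum_divide_distrib algebra_simps)
    also have "\<dots> \<le> K i"
      unfolding K_def
    proof (rule sum_mono)
      fix t assume t: "t \<in> \<Theta>"
      have pos: "(1 + \<rho> t l i) / 2 > 0" if "l < k" for l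
        using \<rho>0[OF t that, of i] by simp
      define y where "y = (\<Prod>l<k. (1 + \<rho> t l i) / 2)"
      have y: "y > 0" unfolding y_def using pos by (intro prod_pos) auto
      have lny: "(\<Sum>l<k. - ln ((1 + \<rho> t l i) / 2)) = - ln y"
        unfolding y_def using pos by (subst ln_prod) (force simp: sum_negf)+
      have "ln y \<le> y - 1" using y by (rule ln_le_minus_one)
      moreover have "ln (y / 2) \<le> y / 2 - 1" using y by (intro ln_le_minus_one) auto
      moreover have "ln (y / 2) = ln y - ln 2" using y by (simp add: ln_div)
      moreover have "ln 2 \<le> (1 :: real)" using ln_le_minus_one[of "2 :: real"] by simp
      \<comment> \<open>\<open>y\<close> is the likelihood ratio \<open>V i t / W t\<close>. If the
        output is \<open>i\<close>, the claim reads \<open>ln y \<le> y / 2\<close>, which is the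
        inequality at \<open>y / 2\<close> together with \<open>ln 2 \<le> 1\<close>.\<close>
      ultimately have "1 - y + of_bool (out t = i) * (y / 2 - 1) \<le> - ln y"
        by (cases "out t = i") auto
      then have "W t * (1 - y + of_bool (out t = i) * (y / 2 - 1)) \<le> W t * - ln y"
        using Wpos[OF t] by (intro mult_left_mono) auto
      then show "W t - V i t + of_bool (out t = i) * (V i t / 2 - W t)
          \<le> W t * (\<Sum>l<k. - ln ((1 + \<rho> t l i) / 2))"
        unfolding lny V[OF t] y_def[symmetric] by (simp add: algebra_simps)
    qed
    finally show ?thesis by simp
  qed
  \<comment> \<open>Law of total probability: the ratio of posterior to prior has mean 1.\<close>
  have mean: "(\<Sum>t\<in>\<Theta>. W t * (\<rho> t l i - 1)) = 0" if l: "l < k" and i: "i < s" for l i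
  proof -
    have "(\<Sum>t\<in>\<Theta>. W t * \<rho> t l i) = (\<Sum>t\<in>\<Theta>. k * (\<Sum>g\<in>R t. w g * of_bool (i \<in> g l)))"
    proof (rule sum.cong)
      fix t assume t: "t \<in> \<Theta>"
      have "(\<Sum>g\<in>R t. w g * of_bool (i \<in> g l))
          = W t * ((\<Sum>C\<in>S t l. \<nu> C * of_bool (i \<in> C)) / N t l)"
        unfolding R[OF t] w_def W[OF t] N_def
        using fS l N[OF t l] by (intro sum_PiE_marginal) (auto simp: N_def)
      then show "W t * \<rho> t l i = k * (\<Sum>g\<in>R t. w g * of_bool (i \<in> g l))"
        unfolding \<rho>_def using k by (simp add: field_simps)
    qed simp
    also have "\<dots> = k * (\<Sum>g\<in>X. w g * of_bool (i \<in> g l))"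
      unfolding sum_distrib_left[symmetric] group by simp
    also have "(\<Sum>g\<in>X. w g * of_bool (i \<in> g l)) = 1 / k"
      unfolding X_def assignments_def w_def using l
      by (subst sum_PiE_marginal[where u = "\<lambda>C. of_bool (i \<in> C)"])
        (auto simp: \<nu>_def row_weight_def sum_bernoulli_weight sum_bernoulli_weight_member[OF i]
          simp del: sum_mult_of_bool_eq)
    finally show ?thesis using k sumW by (simp add: right_diff_distrib sum_subtractf)
  qed
  have sumK: "(\<Sum>i<s. K i) \<le> k * ln (card \<Theta>)"
  proof -
    \<comment> \<open>Terms of mean zero are inserted to match the left side of
      \<open>neg_ln_half_one_plus_le\<close>.\<close>
    have "(\<Sum>i<s. K i) = (\<Sum>i<s. K i + (\<Sum>l<k. (\<Sum>t\<in>\<Theta>. W t * (\<rho> t l i - 1)) / 2))"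
      using mean by (intro sum.cong) auto
    also have "\<dots> = (\<Sum>i<s. \<Sum>t\<in>\<Theta>. \<Sum>l<k. W t * (- ln ((1 + \<rho> t l i) / 2) + (\<rho> t l i - 1) / 2))"
    proof (rule sum.cong)
      fix i
      have "(\<Sum>l<k. (\<Sum>t\<in>\<Theta>. W t * (\<rho> t l i - 1)) / 2) = (\<Sum>t\<in>\<Theta>. \<Sum>l<k. W t * ((\<rho> t l i - 1) / 2))"
        unfolding sum_divide_distrib by (subst sum.swap) simp
      then show "K i + (\<Sum>l<k. (\<Sum>t\<in>\<Theta>. W t * (\<rho> t l i - 1)) / 2)
          = (\<Sum>t\<in>\<Theta>. \<Sum>l<k. W t * (- ln ((1 + \<rho> t l i) / 2) + (\<rho> t l i - 1) / 2))"
        unfolding K_def sum_distrib_left distrib_left sum.distrib by simp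
    qed simp
    also have "\<dots> = (\<Sum>t\<in>\<Theta>. W t * (\<Sum>l<k. \<Sum>i<s. - ln ((1 + \<rho> t l i) / 2) + (\<rho> t l i - 1) / 2))"
      unfolding sum_distrib_left
      by (subst sum.swap, rule sum.cong, simp, subst sum.swap, simp)
    also have "\<dots> \<le> (\<Sum>t\<in>\<Theta>. W t * (k * - ln (W t)))"
    proof (intro sum_mono mult_left_mono)
      fix t assume t: "t \<in> \<Theta>"
      have "(\<Sum>l<k. \<Sum>i<s. - ln ((1 + \<rho> t l i) / 2) + (\<rho> t l i - 1) / 2)
          \<le> (\<Sum>l<k. - ln (N t l) / (1 / k))"
      proof (rule sum_mono)
        fix l assume "l \<in> {..<k}"
        then have l: "l < k" by simp
        have "(\<Sum>i<s. - ln ((1 + \<rho> t l i) / 2) + (\<rho> t l i - 1) / 2)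
            \<le> (\<Sum>i<s. \<rho> t l i * ln (\<rho> t l i) - \<rho> t l i + 1)"
          using \<rho>0[OF t l] by (intro sum_mono neg_ln_half_one_plus_le)
        \<comment> \<open>The factor \<open>k\<close> of the final bound originates here, as the
          inverse of the density.\<close>
        also have "\<dots> \<le> - ln (N t l) / (1 / k)"
          unfolding N_def \<nu>_def row_weight_def
          using k S[OF t l] by (intro bernoulli_information) (auto simp: \<rho>_def N_def \<nu>_def row_weight_def)
        finally show "(\<Sum>i<s. - ln ((1 + \<rho> t l i) / 2) + (\<rho> t l i - 1) / 2) \<le> - ln (N t l) / (1 / k)" .
      qed
      also have "\<dots> = k * - ln (W t)"
        unfolding W[OF t] using N[OF t]
        by (subst ln_prod) (force simp: sum_negf sum_distrib_left sum_distrib_right mult.commute)+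
      finally show "(\<Sum>l<k. \<Sum>i<s. - ln ((1 + \<rho> t l i) / 2) + (\<rho> t l i - 1) / 2) \<le> k * - ln (W t)" .
    qed (use Wpos in \<open>auto simp: less_imp_le\<close>)
    also have "\<dots> = k * (\<Sum>t\<in>\<Theta>. W t * - ln (W t))"
      by (simp add: sum_distrib_left algebra_simps)
    also have "\<dots> \<le> k * ln (card \<Theta>)"
      using Wpos sumW f\<Theta> by (intro mult_left_mono entropy_le_ln_card) auto
    finally show ?thesis .
  qed
  \<comment> \<open>The unplanted law is the same for all \<open>i\<close>, so the events of output
    \<open>i\<close> are disjoint events of one distribution.\<close>
  have sum\<eta>: "(\<Sum>i<s. \<eta> i) \<le> 1"
  proof -
    have "(\<Sum>i<s. \<eta> i) = (\<Sum>t\<in>\<Theta>. W t * (\<Sum>i<s. of_bool (out t = i)))"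
      unfolding \<eta>_def sum_distrib_left by (rule sum.swap)
    also have "\<dots> \<le> (\<Sum>t\<in>\<Theta>. W t * 1)"
    proof (intro sum_mono mult_left_mono)
      fix t
      have "(\<Sum>i<s. of_bool (out t = i)) = (\<Sum>i<s. if i = out t then 1 else 0 :: real)"
        by (intro sum.cong) auto
      also have "\<dots> \<le> 1" by simp
      finally show "(\<Sum>i<s. of_bool (out t = i)) \<le> (1 :: real)" .
    qed (use Wpos in \<open>auto simp: less_imp_le\<close>)
    finally show ?thesis using sumW by simp
  qed
  have "(\<Sum>i<s. \<tau> i) \<le> (\<Sum>i<s. 2 * (K i + \<eta> i))"
    using \<tau>_le by (intro sum_mono) auto
  also have "\<dots> = 2 * ((\<Sum>i<s. K i) + (\<Sum>i<s. \<eta> i))"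
    by (simp add: sum_distrib_left sum.distrib)
  also have "\<dots> \<le> 2 * (k * ln (card \<Theta>) + 1)"
    using sumK sum\<eta> by simp
  finally show ?thesis
    unfolding \<tau>[symmetric] by (simp only: X_def \<Theta>_def)
qed

section \<open>The share of the planted coordinate\<close>

text \<open>Reduces moments of order \<open>p\<close> to exponential moments, which factor over the
  servers.\<close>

lemma powr_le_const_mult_exp:
  fixes p y :: real
  assumes "p > 0" "y \<ge> 0"
  shows "y powr p \<le> p powr p * exp y"
proof (cases "y = 0")
  case False
  then have y: "y > 0" using assms by simp
  have "ln (y / p) \<le> y / p - 1" using y assms by (intro ln_le_minus_one) auto
  then have "p * ln (y / p) \<le> p * (y / p - 1)" using assms by (intro mult_left_mono) auto
  then have "p * ln y \<le> p * ln p + y"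
    using y assms by (simp add: ln_div algebra_simps)
  then have "exp (p * ln y) \<le> exp (p * ln p + y)" by simp
  then show ?thesis using y assms by (simp add: powr_def exp_add)
qed simp

text \<open>Bernoulli's inequality for real exponents, from \<open>y * ln y \<ge> y - 1\<close> and
  \<open>exp z \<ge> 1 + z\<close>.\<close>

lemma powr_ge_tangent_one:
  fixes y r :: real
  assumes "y \<ge> 0" "r \<ge> 1"
  shows "y powr r \<ge> 1 + r * (y - 1)"
proof (cases "y = 0")
  case False
  then have y: "y > 0" using assms by simp
  have "ln (1 / y) \<le> 1 / y - 1" using y by (intro ln_le_minus_one) auto
  then have "y * - ln y \<le> y * (1 / y - 1)"
    using y by (intro mult_left_mono) (auto simp: ln_div)
  then have "y * ln y \<ge> y - 1" using y by (simp add: algebra_simps)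
  then have "(r - 1) * (y * ln y) \<ge> (r - 1) * (y - 1)"
    using assms by (intro mult_left_mono) auto
  then have "1 + r * (y - 1) \<le> y * (1 + (r - 1) * ln y)"
    by (simp add: algebra_simps)
  also have "\<dots> \<le> y * exp ((r - 1) * ln y)"
    using y exp_ge_add_one_self by (intro mult_left_mono) auto
  also have "\<dots> = y powr 1 * y powr (r - 1)"
    using y by (simp add: powr_def)
  also have "\<dots> = y powr r"
    unfolding powr_add[symmetric] by simp
  finally show ?thesis .
qed (use assms in auto)

section \<open>Moments of the sum vector under planting\<close>

definition hits :: "nat \<Rightarrow> (nat \<Rightarrow> nat set) \<Rightarrow> nat \<Rightarrow> real" where
  "hits k g i = (\<Sum>l<k. of_bool (i \<in> g l))"

lemma hits_nonneg: "hits k g i \<ge> 0"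
  unfolding hits_def by (intro sum_nonneg) auto

lemma hits_le: "hits k g i \<le> k"
proof -
  have "hits k g i \<le> (\<Sum>l<k. 1)" unfolding hits_def by (intro sum_mono) auto
  then show ?thesis by simp
qed

lemma planted_hits_mean:
  assumes k: "k > 1" and i: "i < s"
  shows "(\<Sum>g\<in>assignments k s. planted_weight k s i g * hits k g i) \<ge> k / 2"
proof -
  have "(\<Sum>C\<in>Pow {..<s}. planted_row k s i C * of_bool (i \<in> C))
      = (\<Sum>C\<in>Pow {..<s}. bernoulli_weight s (\<lambda>e. if e = i then (1 + 1 / k) / 2 else 1 / k) C
          * of_bool (i \<in> C))"
    by (intro sum.cong refl) (simp only: planted_row_eq[OF k i] Pow_iff)
  also have "\<dots> = (1 + 1 / k) / 2"
    by (subst sum_bernoulli_weight_member[OF i]) simp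
  finally have marg: "(\<Sum>g\<in>assignments k s. planted_weight k s i g * of_bool (i \<in> g l)) = (1 + 1 / k) / 2"
    if "l < k" for l
    unfolding assignments_def planted_weight_def using that
    by (subst sum_PiE_marginal[where u = "\<lambda>C. of_bool (i \<in> C)"])
      (auto simp: sum_planted_row[OF k i] simp del: sum_mult_of_bool_eq)
  have "(\<Sum>g\<in>assignments k s. planted_weight k s i g * hits k g i)
      = (\<Sum>l<k. \<Sum>g\<in>assignments k s. planted_weight k s i g * of_bool (i \<in> g l))"
    unfolding hits_def sum_distrib_left by (rule sum.swap)
  also have "\<dots> = (\<Sum>l<k. (1 + 1 / k) / 2)"
    by (intro sum.cong refl marg) simp
  also have "\<dots> = (k + 1) / 2"
    using k by (simp add: field_simps)
  finally show ?thesis by simp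
qed

text \<open>A coordinate other than \<open>i\<close> keeps density \<open>1 / k\<close>, so
  independence gives \<open>(1 + (exp 1 - 1) / k) ^ k\<close>, bounded uniformly in
  \<open>k\<close>.\<close>

lemma planted_exp_hits_le:
  assumes k: "k > 1" and i: "i < s" and j: "j < s" "j \<noteq> i"
  shows "(\<Sum>g\<in>assignments k s. planted_weight k s i g * exp (hits k g j)) \<le> exp 2"
proof -
  have "(\<Sum>g\<in>assignments k s. planted_weight k s i g * exp (hits k g j))
      = (\<Sum>g\<in>assignments k s. \<Prod>l<k. planted_row k s i (g l) * (if j \<in> g l then exp 1 else 1))"
  proof (rule sum.cong)
    fix g
    have "exp (hits k g j) = (\<Prod>l<k. if j \<in> g l then exp 1 else 1)"
      unfolding hits_def by (subst exp_sum) (auto intro!: prod.cong)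
    then show "planted_weight k s i g * exp (hits k g j)
        = (\<Prod>l<k. planted_row k s i (g l) * (if j \<in> g l then exp 1 else 1))"
      by (simp only: planted_weight_def prod.distrib)
  qed simp
  also have "\<dots> = (\<Prod>l<k. \<Sum>C\<in>Pow {..<s}. planted_row k s i C * (if j \<in> C then exp 1 else 1))"
    unfolding assignments_def by (subst prod_sum_PiE) auto
  also have "(\<Sum>C\<in>Pow {..<s}. planted_row k s i C * (if j \<in> C then exp 1 else 1))
      = (\<Sum>C\<in>Pow {..<s}. bernoulli_weight s (\<lambda>e. if e = i then (1 + 1 / k) / 2 else 1 / k) C
          * (if j \<in> C then exp 1 else 1))"
    by (intro sum.cong refl) (simp only: planted_row_eq[OF k i] Pow_iff)
  also have "\<dots> = 1 - 1 / k + 1 / k * exp 1"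
    using j by (subst sum_bernoulli_weight_single) auto
  also have "(\<Prod>l<k. 1 - 1 / k + 1 / k * exp 1) \<le> (\<Prod>l<k. exp (2 / k))"
  proof (rule prod_mono, intro conjI)
    show "0 \<le> 1 - 1 / real k + 1 / real k * exp 1"
      using k by (intro add_nonneg_nonneg) auto
    have "1 - 1 / real k + 1 / real k * exp 1 = 1 + (exp 1 - 1) / k"
      by (simp add: diff_divide_distrib)
    also have "\<dots> \<le> 1 + 2 / k"
      using exp_le by (intro add_left_mono divide_right_mono) auto
    also have "\<dots> \<le> exp (2 / k)" by (rule exp_ge_add_one_self)
    finally show "1 - 1 / real k + 1 / real k * exp 1 \<le> exp (2 / k)" .
  qed
  also have "\<dots> = exp 2"
    using k by (simp flip: exp_of_nat_mult)
  finally show ?thesis .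
qed

text \<open>The numerator is \<open>(1 / 2) powr p\<close>, written as the square that the
  optimization produces; \<open>p powr p * exp 2\<close> bounds the moment of order \<open>p\<close>
  of an unplanted entry.\<close>

definition share_const :: "real \<Rightarrow> real" where
  "share_const p = ((1 / 2) powr (p / 2))\<^sup>2 / (2 + p powr p * exp 2)"

lemma share_const_pos: "share_const p > 0"
  unfolding share_const_def by (intro divide_pos_pos add_pos_nonneg) auto

text \<open>In units of \<open>k powr p\<close>, the planted entry contributes about
  \<open>(1 / 2) powr p\<close>, while the rest has bounded mean because
  \<open>s \<le> k powr p\<close>. An affine minorant of the share reduces the claim to these
  means.\<close>

lemma planted_share_ge:
  assumes p: "p \<ge> 2" and k: "k > 1" and i: "i < s" and s: "real s \<le> real k powr p"
  shows "(\<Sum>g\<in>assignments k s. planted_weight k s i g *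
           (hits k g i powr p / ((\<Sum>l<s. hits k g l powr p) + 1))) \<ge> share_const p"
proof -
  define \<kappa> where "\<kappa> = real k powr p"
  define u where "u = (1 / 2 :: real) powr (p / 2)"
  define A where "A = p powr p * exp 2"
  define D where "D = 2 + A"
  \<comment> \<open>The noise in units of \<open>\<kappa>\<close>; the summand 1 stems from the
    extra coordinate that keeps the sum vector nonzero.\<close>
  define z where "z g = ((\<Sum>l\<in>{..<s} - {i}. hits k g l powr p) + 1) / \<kappa>" for g
  \<comment> \<open>The maximizer of \<open>2 * \<xi> * u - \<xi>\<^sup>2 * D\<close>, with maximum
    \<open>share_const p\<close>.\<close>
  define \<xi> where "\<xi> = u / D"
  let ?E = "\<lambda>f. \<Sum>g\<in>assignments k s. planted_weight k s i g * f g"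
  have \<kappa>: "\<kappa> > 0" "\<kappa> \<ge> 1" using k p by (auto simp: \<kappa>_def ge_one_powr_ge_zero)
  have u: "u > 0" by (simp add: u_def)
  have D: "D > 0" unfolding D_def A_def by (intro add_pos_nonneg) auto
  have z0: "z g \<ge> 0" for g
    unfolding z_def using \<kappa> by (intro divide_nonneg_pos add_nonneg_nonneg sum_nonneg) auto
  have \<xi>: "\<xi> > 0" using u D by (simp add: \<xi>_def)
  have pw: "planted_weight k s i g \<ge> 0" for g by (rule planted_weight_nonneg[OF k])
  have point: "2 * \<xi> * (u * (1 + p / 2 * (2 / k * hits k g i - 1))) - \<xi>\<^sup>2 * (1 + z g)
      \<le> hits k g i powr p / ((\<Sum>l<s. hits k g l powr p) + 1)" for g
  proof -
    define y where "y = hits k g i / k"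
    define q where "q = y powr (p / 2)"
    have y: "0 \<le> y" "y \<le> 1" using hits_nonneg hits_le k by (auto simp: y_def divide_le_eq_1)
    have q1: "q \<le> 1" unfolding q_def using y p by (intro powr_le1) auto
    have q0: "q \<ge> 0" by (simp add: q_def)
    have yq: "y powr p = q\<^sup>2"
      unfolding q_def power2_eq_square powr_add[symmetric] by simp
    have hq: "hits k g i powr p = \<kappa> * q\<^sup>2"
      unfolding yq[symmetric] y_def \<kappa>_def using k hits_nonneg by (simp add: powr_divide)
    have "(\<Sum>l<s. hits k g l powr p) + 1 = \<kappa> * (q\<^sup>2 + z g)"
      using i \<kappa> by (subst sum.remove[of _ i]) (auto simp: z_def hq field_simps)
    then have "hits k g i powr p / ((\<Sum>l<s. hits k g l powr p) + 1) = q\<^sup>2 / (q\<^sup>2 + z g)"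
      using \<kappa> by (simp add: hq)
    moreover have "q\<^sup>2 / (1 + z g) \<le> q\<^sup>2 / (q\<^sup>2 + z g)"
    proof (cases "q = 0")
      case False
      have "q\<^sup>2 + z g > 0" using False z0[of g] by (intro add_pos_nonneg) auto
      moreover have "q\<^sup>2 \<le> 1" using q0 q1 by (simp add: power_le_one)
      ultimately show ?thesis by (intro divide_left_mono) (auto intro!: mult_pos_pos)
    qed simp
    \<comment> \<open>AM-GM; it makes the bound linear in \<open>q\<close> and \<open>z g\<close>, so that no independence is needed.\<close>
    moreover have "2 * \<xi> * q - \<xi>\<^sup>2 * (1 + z g) \<le> q\<^sup>2 / (1 + z g)"
    proof -
      have "0 \<le> (q - \<xi> * (1 + z g))\<^sup>2" by simp
      then have "(2 * \<xi> * q - \<xi>\<^sup>2 * (1 + z g)) * (1 + z g) \<le> q\<^sup>2"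
        by (simp add: power2_eq_square algebra_simps)
      then show ?thesis using z0[of g] by (simp add: pos_le_divide_eq)
    qed
    \<comment> \<open>Tangent of the convex function \<open>y powr (p / 2)\<close> at
      \<open>y = 1 / 2\<close>.\<close>
    moreover have "u * (1 + p / 2 * (2 / k * hits k g i - 1)) \<le> q"
    proof -
      have "1 + p / 2 * (2 * y - 1) \<le> (2 * y) powr (p / 2)"
        using y p by (intro powr_ge_tangent_one) auto
      then have "u * (1 + p / 2 * (2 * y - 1)) \<le> u * (2 * y) powr (p / 2)"
        using u by (intro mult_left_mono) auto
      also have "\<dots> = q"
        unfolding u_def q_def using y by (subst powr_mult[symmetric]) auto
      finally show ?thesis by (simp add: y_def)
    qed
    then have "2 * \<xi> * (u * (1 + p / 2 * (2 / k * hits k g i - 1))) \<le> 2 * \<xi> * q"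
      using \<xi> by (intro mult_left_mono) auto
    ultimately show ?thesis by linarith
  qed
  have one: "(\<Sum>g\<in>assignments k s. planted_weight k s i g) = 1"
    by (rule sum_planted_weight[OF k i])
  have Ez: "?E z \<le> 1 + A"
  proof -
    have "?E z = (\<Sum>g\<in>assignments k s. \<Sum>l\<in>{..<s} - {i}. planted_weight k s i g * hits k g l powr p / \<kappa>)
        + (\<Sum>g\<in>assignments k s. planted_weight k s i g) / \<kappa>"
      unfolding z_def add_divide_distrib distrib_left sum.distrib
      by (simp add: sum_distrib_left sum_divide_distrib)
    also have "\<dots> = (\<Sum>l\<in>{..<s} - {i}. ?E (\<lambda>g. hits k g l powr p) / \<kappa>) + 1 / \<kappa>"
      unfolding one by (subst sum.swap) (simp add: sum_divide_distrib)
    also have "\<dots> \<le> (\<Sum>l\<in>{..<s} - {i}. A / \<kappa>) + 1"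
    proof (intro add_mono sum_mono divide_right_mono)
      fix l assume l: "l \<in> {..<s} - {i}"
      have "?E (\<lambda>g. hits k g l powr p) \<le> ?E (\<lambda>g. p powr p * exp (hits k g l))"
        using pw p hits_nonneg by (intro sum_mono mult_left_mono powr_le_const_mult_exp) auto
      also have "\<dots> = p powr p * ?E (\<lambda>g. exp (hits k g l))"
        by (simp add: sum_distrib_left algebra_simps)
      also have "\<dots> \<le> A"
        unfolding A_def using l by (intro mult_left_mono planted_exp_hits_le k i) auto
      finally show "?E (\<lambda>g. hits k g l powr p) \<le> A" .
    qed (use \<kappa> in auto)
    also have "(\<Sum>l\<in>{..<s} - {i}. A / \<kappa>) \<le> (\<Sum>l<s. A / \<kappa>)"
      using \<kappa> by (intro sum_mono2) (auto simp: A_def)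
    also have "(\<Sum>l<s. A / \<kappa>) = s / \<kappa> * A" by simp
    also have "\<dots> \<le> 1 * A"
      using s \<kappa> by (intro mult_right_mono) (auto simp: A_def divide_le_eq_1 \<kappa>_def)
    finally show ?thesis by simp
  qed
  have "share_const p = 2 * \<xi> * u - \<xi>\<^sup>2 * D"
    unfolding share_const_def u_def[symmetric] A_def[symmetric] D_def[symmetric] \<xi>_def
    using D by (simp add: field_simps power2_eq_square)
  also have "\<dots> \<le> 2 * \<xi> * (u * (1 + p / 2 * (2 / k * ?E (\<lambda>g. hits k g i) - 1))) - \<xi>\<^sup>2 * (1 + ?E z)"
  proof (rule diff_mono)
    have "2 / k * (k / 2) \<le> 2 / k * ?E (\<lambda>g. hits k g i)"
      using planted_hits_mean[OF k i] by (intro mult_left_mono) auto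
    then have "1 \<le> 1 + p / 2 * (2 / k * ?E (\<lambda>g. hits k g i) - 1)"
      using k p by simp
    then have "u * 1 \<le> u * (1 + p / 2 * (2 / k * ?E (\<lambda>g. hits k g i) - 1))"
      using u by (intro mult_left_mono) auto
    then show "2 * \<xi> * u \<le> 2 * \<xi> * (u * (1 + p / 2 * (2 / k * ?E (\<lambda>g. hits k g i) - 1)))"
      using \<xi> by (intro mult_left_mono) auto
    show "\<xi>\<^sup>2 * (1 + ?E z) \<le> \<xi>\<^sup>2 * D"
      using Ez by (intro mult_left_mono) (auto simp: D_def)
  qed
  also have "\<dots> = ?E (\<lambda>g. 2 * \<xi> * (u * (1 + p / 2 * (2 / k * hits k g i - 1))) - \<xi>\<^sup>2 * (1 + z g))"
  proof -
    define a1 a2 where "a1 = 2 * \<xi> * u * (1 - p / 2) - \<xi>\<^sup>2" and "a2 = 2 * \<xi> * u * (p / 2) * (2 / k)"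
    have "?E (\<lambda>g. 2 * \<xi> * (u * (1 + p / 2 * (2 / k * hits k g i - 1))) - \<xi>\<^sup>2 * (1 + z g))
        = ?E (\<lambda>g. a1 + a2 * hits k g i - \<xi>\<^sup>2 * z g)"
      by (intro sum.cong refl arg_cong2[where f = "(*)"]) (simp add: a1_def a2_def algebra_simps)
    also have "\<dots> = a1 * (\<Sum>g\<in>assignments k s. planted_weight k s i g) + a2 * ?E (\<lambda>g. hits k g i) - \<xi>\<^sup>2 * ?E z"
      unfolding sum_distrib_left distrib_left right_diff_distrib sum.distrib sum_subtractf
      by (simp add: mult_ac)
    finally show ?thesis
      unfolding one by (simp add: a1_def a2_def algebra_simps)
  qed
  also have "\<dots> \<le> ?E (\<lambda>g. hits k g i powr p / ((\<Sum>l<s. hits k g l powr p) + 1))"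
    using point pw by (intro sum_mono mult_left_mono) auto
  finally show ?thesis .
qed

section \<open>Lower bounds for samplers\<close>

text \<open>Coordinate \<open>s\<close>, always held by server \<open>0\<close>, keeps the sum vector nonzero.\<close>

definition encode :: "nat \<Rightarrow> nat \<Rightarrow> (nat \<Rightarrow> nat set) \<Rightarrow> nat \<Rightarrow> nat \<Rightarrow> nat" where
  "encode k s g j i = (if j < k then of_bool (i < s \<and> i \<in> g j) + of_bool (j = 0 \<and> i = s) else 0)"

lemma total_vector_encode:
  assumes "k > 0"
  shows "real (total_vector k (encode k s g) i) = (if i < s then hits k g i else of_bool (i = s))"
proof -
  have "real (total_vector k (encode k s g) i)
      = (\<Sum>j<k. of_bool (i < s \<and> i \<in> g j) + (if j = 0 then of_bool (i = s) else 0))"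
    unfolding total_vector_def of_nat_sum by (intro sum.cong) (auto simp: encode_def)
  also have "\<dots> = (\<Sum>j<k. of_bool (i < s \<and> i \<in> g j)) + of_bool (i = s)"
    using assms by (simp add: sum.distrib)
  finally show ?thesis by (simp add: hits_def)
qed

lemma encode_in_inputs:
  assumes "k > 0" "s < n" "m \<ge> 1"
  shows "encode k s g \<in> inputs k n m"
proof -
  have "enat (encode k s g j i) \<le> m" for j i
  proof -
    have "encode k s g j i \<le> 1" by (auto simp: encode_def)
    then show ?thesis using assms(3) by (metis enat_ord_simps(1) one_enat_def order_trans)
  qed
  moreover have "encode k s g j i = 0" if "j \<ge> k \<or> i \<ge> n" for j i
    using that assms by (auto simp: encode_def)
  moreover have "total_vector k (encode k s g) s \<noteq> 0"
    using total_vector_encode[OF assms(1), of s g s] by auto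
  ultimately show ?thesis using assms(2) by (auto simp: inputs_def)
qed

lemma powr_norm_encode:
  assumes "k > 0" "s < n" "p > 0"
  shows "(\<Sum>l<n. real (total_vector k (encode k s g) l) powr p) = (\<Sum>l<s. hits k g l powr p) + 1"
proof -
  have "(\<Sum>l<n. real (total_vector k (encode k s g) l) powr p)
      = (\<Sum>l<Suc s. real (total_vector k (encode k s g) l) powr p)"
    using assms by (intro sum.mono_neutral_right) (auto simp: total_vector_encode)
  then show ?thesis using assms by (simp add: total_vector_encode)
qed

text \<open>By well-ordering of \<open>enat\<close> the infimum is attained, so the cost itself is
  an almost sure bound.\<close>

lemma bits_le_comm_cost:
  assumes "comm_cost k n m M \<le> B" and "x \<in> inputs k n m"
  shows "AE P in M. bits P x \<le> B"
proof -
  let ?A = "{B. \<forall>x\<in>inputs k n m. AE P in M. bits P x \<le> B}"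
  have "\<infinity> \<in> ?A" by simp
  then have "(LEAST B. B \<in> ?A) \<in> ?A" by (rule LeastI)
  moreover have "comm_cost k n m M = (LEAST B. B \<in> ?A)"
    unfolding comm_cost_def Inf_enat_def using \<open>\<infinity> \<in> ?A\<close> by (metis empty_iff)
  ultimately have "comm_cost k n m M \<in> ?A" by metis
  then have "AE P in M. bits P x \<le> comm_cost k n m M" using assms(2) by blast
  then show ?thesis using assms(1) by (auto elim: eventually_mono)
qed

text \<open>The planted hits, summed over \<open>i\<close>, are averaged over the protocols in two
  ways: sampling forces a constant share for each \<open>i\<close>, while \<open>2 ^ B\<close>
  transcripts limit the total.\<close>

lemma superlinear_bound:
  assumes sampler: "perfect_Lp_sampler p C k n m M" and cost: "comm_cost k n m M \<le> enat B"
    and p: "p \<ge> 2" and k: "k > 1" and s: "real s \<le> real k powr p" "s < n" and m: "m \<ge> 1"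
  shows "s * (share_const p - real n powr (- C)) \<le> 2 * (k * (B * ln 2) + 1)"
proof -
  interpret prob_space M
    using sampler by (simp add: perfect_Lp_sampler_def randomized_protocol_def)
  let ?X = "assignments k s"
  define Out where "Out i g = {P \<in> space M. outputs P (encode k s g) i}" for i g
  have inp: "encode k s g \<in> inputs k n m" for g
    using k s m by (intro encode_in_inputs) auto
  have ev: "Out i g \<in> events" for i g
    using sampler inp[of g] by (auto simp: perfect_Lp_sampler_def randomized_protocol_def Out_def)
  have pr: "prob (Out i g) \<ge> hits k g i powr p / ((\<Sum>l<s. hits k g l powr p) + 1) - real n powr (- C)"
    if i: "i < s" for i g
  proof -
    have "\<bar>prob (Out i g) - real (total_vector k (encode k s g) i) powr p /
        (\<Sum>l<n. real (total_vector k (encode k s g) l) powr p)\<bar> \<le> real n powr (- C)"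
      using sampler inp[of g] i s by (auto simp: perfect_Lp_sampler_def Out_def)
    then show ?thesis
      using i s k p powr_norm_encode[of k s n p g] by (simp add: total_vector_encode)
  qed
  \<comment> \<open>Only finitely many inputs occur, so one null set serves all of them.\<close>
  have "AE P in M. \<forall>g\<in>?X. bits P (encode k s g) \<le> enat B"
    using bits_le_comm_cost[OF cost] inp by (intro AE_finite_allI finite_assignments) auto
  then have AE: "AE P in M. (\<Sum>y\<in>{..<s} \<times> ?X. planted_weight k s (fst y) (snd y)
      * indicator (Out (fst y) (snd y)) P) \<le> 2 * (k * (B * ln 2) + 1)"
    using AE_space
  proof eventually_elim
    case (elim P)
    define T where "T g = run P (encode k s g) B" for g
    \<comment> \<open>The default \<open>s\<close> is not among the counted coordinates, so a
      transcript without output scores no hit.\<close>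
    define out where "out t = (case coordinator P t of Output i \<Rightarrow> i | _ \<Rightarrow> s)" for t
    have valid: "valid_protocol k n P"
      using sampler elim by (auto simp: perfect_Lp_sampler_def randomized_protocol_def)
    have ind: "indicator (Out i g) P \<le> (of_bool (out (T g) = i) :: real)" if "g \<in> ?X" for i g
      using elim that outputs_iff[of P "encode k s g" B i]
      by (auto simp: Out_def out_def T_def indicator_def)
    have "(\<Sum>y\<in>{..<s} \<times> ?X. planted_weight k s (fst y) (snd y) * indicator (Out (fst y) (snd y)) P)
        \<le> (\<Sum>y\<in>{..<s} \<times> ?X. planted_weight k s (fst y) (snd y) * of_bool (out (T (snd y)) = fst y))"
      using planted_weight_nonneg[OF k] by (intro sum_mono mult_left_mono ind) auto
    also have "\<dots> = (\<Sum>i<s. \<Sum>g\<in>?X. planted_weight k s i g * of_bool (out (T g) = i))"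
      unfolding sum.cartesian_product by (intro sum.cong) auto
    also have "\<dots> \<le> 2 * (k * ln (card (T ` ?X)) + 1)"
    proof (rule sum_planted_hits_le[OF k])
      fix t g
      assume g: "g \<in> ?X" "\<And>l. l < k \<Longrightarrow> \<exists>g'\<in>?X. T g' = t \<and> g' l = g l"
      show "T g = t"
        unfolding T_def
      proof (rule run_rectangle[OF valid])
        fix j assume "j < k"
        then obtain g' where g': "T g' = t" "g' j = g j" using g(2) by blast
        then have "encode k s g' j = encode k s g j" by (auto simp: encode_def fun_eq_iff)
        then show "\<exists>y. run P y B = t \<and> y j = encode k s g j" using g' by (auto simp: T_def)
      qed (use k in auto)
    qed
    also have "\<dots> \<le> 2 * (k * (B * ln 2) + 1)"
    proof -
      have "T ` ?X = (\<lambda>x. run P x B) ` encode k s ` ?X" by (auto simp: T_def)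
      then have c: "card (T ` ?X) \<le> 2 ^ B" using card_runs_le[of P B "encode k s ` ?X"] by simp
      have "?X \<noteq> {}" by (auto simp: assignments_def PiE_eq_empty_iff)
      then have "card (T ` ?X) > 0" using finite_assignments by (simp add: card_gt_0_iff)
      then have "ln (card (T ` ?X)) \<le> ln (2 ^ B)" using c by (subst ln_le_cancel_iff) (auto simp flip: of_nat_le_iff)
      also have "\<dots> = B * ln 2" by (simp add: ln_realpow)
      finally have "k * ln (card (T ` ?X)) \<le> k * (B * ln 2)" by (intro mult_left_mono) auto
      then show ?thesis by simp
    qed
    finally show ?case .
  qed
  have "s * (share_const p - real n powr (- C)) = (\<Sum>i<s. share_const p - real n powr (- C))"
    by simp
  also have "\<dots> \<le> (\<Sum>i<s. \<Sum>g\<in>?X. planted_weight k s i g * prob (Out i g))"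
  proof (rule sum_mono)
    fix i assume "i \<in> {..<s}"
    then have i: "i < s" by simp
    have "share_const p - real n powr (- C) \<le> (\<Sum>g\<in>?X. planted_weight k s i g *
        (hits k g i powr p / ((\<Sum>l<s. hits k g l powr p) + 1)))
        - real n powr (- C) * (\<Sum>g\<in>?X. planted_weight k s i g)"
      using planted_share_ge[OF p k i s(1)] sum_planted_weight[OF k i] by simp
    also have "\<dots> = (\<Sum>g\<in>?X. planted_weight k s i g *
        (hits k g i powr p / ((\<Sum>l<s. hits k g l powr p) + 1) - real n powr (- C)))"
      unfolding right_diff_distrib sum_subtractf sum_distrib_left by (simp add: mult.commute)
    also have "\<dots> \<le> (\<Sum>g\<in>?X. planted_weight k s i g * prob (Out i g))"
      using pr[OF i] planted_weight_nonneg[OF k] by (intro sum_mono mult_left_mono) auto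
    finally show "share_const p - real n powr (- C) \<le> (\<Sum>g\<in>?X. planted_weight k s i g * prob (Out i g))" .
  qed
  also have "\<dots> = (\<Sum>y\<in>{..<s} \<times> ?X. planted_weight k s (fst y) (snd y) * prob (Out (fst y) (snd y)))"
    unfolding sum.cartesian_product by (intro sum.cong) auto
  also have "\<dots> \<le> 2 * (k * (B * ln 2) + 1)"
    using ev AE finite_assignments by (intro sum_prob_le_if_AE) auto
  finally show ?thesis .
qed

text \<open>Output 0 on \<open>x j\<close> requires output 0 on \<open>x 0\<close> or contact with
  server \<open>j\<close> on \<open>x 0\<close>, and a transcript of \<open>B\<close> bits contacts
  at most \<open>B\<close> servers.\<close>

lemma linear_bound:
  assumes sampler: "perfect_Lp_sampler p C k n m M" and cost: "comm_cost k n m M \<le> enat B"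
    and p: "p > 0" and k: "k > 0" and n: "n > 1" and m: "m \<ge> 1"
  shows "(real k - 1) * (1 / 2 - 2 * real n powr (- C)) \<le> B"
proof -
  interpret prob_space M
    using sampler by (simp add: perfect_Lp_sampler_def randomized_protocol_def)
  \<comment> \<open>Server 0 always holds coordinate 1. In addition, for \<open>j > 0\<close>,
    server \<open>j\<close> holds coordinate 0, which then has share \<open>1 / 2\<close>;
    \<open>x 0\<close> is the base input.\<close>
  define x :: "nat \<Rightarrow> nat \<Rightarrow> nat \<Rightarrow> nat"
    where "x j = encode k 1 (\<lambda>l. if 0 < j \<and> l = j then {0} else {})" for j
  define Out where "Out j = {P \<in> space M. outputs P (x j) 0}" for j
  have inp: "x j \<in> inputs k n m" for j
    unfolding x_def using k n m by (intro encode_in_inputs) auto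
  have ev: "Out j \<in> events" for j
    using sampler inp[of j] by (auto simp: perfect_Lp_sampler_def randomized_protocol_def Out_def)
  have share: "\<bar>prob (Out j) - (if 0 < j then 1 / 2 else 0)\<bar> \<le> real n powr (- C)" if "j < k" for j
  proof -
    have h: "hits k (\<lambda>l. if 0 < j \<and> l = j then {0} else {}) 0 = of_bool (0 < j)"
    proof -
      have "hits k (\<lambda>l. if 0 < j \<and> l = j then {0} else {}) 0 = (\<Sum>l<k. if l = j then of_bool (0 < j) else 0)"
        unfolding hits_def by (intro sum.cong) auto
      then show ?thesis using that by simp
    qed
    have norm: "(\<Sum>l<n. real (total_vector k (x j) l) powr p) = of_bool (0 < j) + 1"
      unfolding x_def using k n p by (subst powr_norm_encode) (auto simp: h)
    have "\<bar>prob (Out j) - real (total_vector k (x j) 0) powr p /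
        (\<Sum>l<n. real (total_vector k (x j) l) powr p)\<bar> \<le> real n powr (- C)"
      using sampler inp[of j] n by (auto simp: perfect_Lp_sampler_def Out_def)
    then show ?thesis
      unfolding norm using k p by (auto simp: x_def total_vector_encode h split: if_splits)
  qed
  have split: "(\<Sum>j<k. f j) = f 0 + (\<Sum>j\<in>{1..<k}. f j)" for f :: "nat \<Rightarrow> real"
  proof -
    have "{..<k} = insert 0 {1..<k}" using k by auto
    then show ?thesis by simp
  qed
  \<comment> \<open>The base input is subtracted once for each of the \<open>k - 1\<close> other
    servers.\<close>
  define c :: "nat \<Rightarrow> real" where "c j = (if j = 0 then - (real k - 1) else 1)" for j
  have "AE P in M. \<forall>j\<in>{..<k}. bits P (x j) \<le> enat B"
    using bits_le_comm_cost[OF cost] inp by (intro AE_finite_allI) auto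
  then have AE: "AE P in M. (\<Sum>j<k. c j * indicator (Out j) P) \<le> B"
    using AE_space
  proof eventually_elim
    case (elim P)
    define t where "t = run P (x 0) B"
    have ind: "indicator (Out j) P \<le> indicator (Out 0) P + (of_bool (j \<in> fst ` set t) :: real)"
      if j: "j \<in> {1..<k}" for j
    proof (cases "j \<in> fst ` set t")
      case False
      have "run P (x j) B = run P (x 0) B"
        using False by (intro run_cong_uncontacted[of j]) (auto simp: x_def encode_def t_def fun_eq_iff)
      then have "outputs P (x j) 0 = outputs P (x 0) 0"
        using elim j outputs_iff[of P "x j" B 0] outputs_iff[of P "x 0" B 0] by auto
      then show ?thesis by (auto simp: Out_def indicator_def)
    qed (auto simp: indicator_def)
    have "(\<Sum>j<k. c j * indicator (Out j) P)
        = - (real k - 1) * indicator (Out 0) P + (\<Sum>j\<in>{1..<k}. indicator (Out j) P)"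
      unfolding split by (intro arg_cong2[where f = "(+)"] sum.cong) (auto simp: c_def)
    also have "\<dots> \<le> - (real k - 1) * indicator (Out 0) P
        + (\<Sum>j\<in>{1..<k}. indicator (Out 0) P + (of_bool (j \<in> fst ` set t) :: real))"
      using ind by (intro add_left_mono sum_mono)
    also have "\<dots> = (\<Sum>j\<in>{1..<k}. of_bool (j \<in> fst ` set t))"
      using k by (simp add: sum.distrib of_nat_diff algebra_simps)
    also have "\<dots> = card ({1..<k} \<inter> fst ` set t)"
      by simp
    also have "\<dots> \<le> B"
    proof -
      have "card ({1..<k} \<inter> fst ` set t) \<le> card (set t)"
        by (rule order_trans[OF card_mono card_image_le]) auto
      also have "\<dots> \<le> length t" by (rule card_length)
      also have "\<dots> \<le> B" unfolding t_def by (rule length_run_le)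
      finally show ?thesis by simp
    qed
    finally show ?case .
  qed
  have "(real k - 1) * (1 / 2 - 2 * real n powr (- C))
      = - (real k - 1) * real n powr (- C) + (\<Sum>j\<in>{1..<k}. 1 / 2 - real n powr (- C))"
    using k by (simp add: of_nat_diff algebra_simps)
  also have "\<dots> \<le> c 0 * prob (Out 0) + (\<Sum>j\<in>{1..<k}. c j * prob (Out j))"
  proof (rule add_mono)
    have "prob (Out 0) \<le> real n powr (- C)" using share[of 0] k by simp
    then show "- (real k - 1) * real n powr (- C) \<le> c 0 * prob (Out 0)"
      using k by (auto simp: c_def intro: mult_left_mono_neg)
    show "(\<Sum>j\<in>{1..<k}. 1 / 2 - real n powr (- C)) \<le> (\<Sum>j\<in>{1..<k}. c j * prob (Out j))"
    proof (rule sum_mono)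
      fix j assume "j \<in> {1..<k}"
      then show "1 / 2 - real n powr (- C) \<le> c j * prob (Out j)"
        using share[of j] by (auto simp: c_def abs_le_iff)
    qed
  qed
  also have "\<dots> = (\<Sum>j<k. c j * prob (Out j))"
    by (simp only: split)
  also have "\<dots> \<le> B"
    using ev AE by (intro sum_prob_le_if_AE) auto
  finally show ?thesis .
qed

section \<open>Choice of constants and the final bound\<close>

lemma eventually_powr_neg_le:
  fixes C e :: real
  assumes "C > 0" "e > 0"
  shows "\<exists>N. \<forall>n\<ge>N. real n powr (- C) \<le> e"
proof -
  have "(\<lambda>n. real n powr (- C)) \<longlonglongrightarrow> 0"
    using assms by (intro tendsto_neg_powr filterlim_real_sequentially) auto
  then have "eventually (\<lambda>n. real n powr (- C) < e) sequentially"
    using assms by (intro order_tendstoD) auto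
  then show ?thesis by (auto simp: eventually_sequentially intro: less_imp_le)
qed

theorem mainTheorem2:
  fixes p C :: real
  assumes "p \<ge> 1" and "C > 0"
  shows "\<exists>c>0. \<exists>k0. \<forall>k\<ge>k0. \<exists>N. \<forall>n\<ge>N. \<forall>m\<ge>1. \<forall>M :: protocol measure.
           perfect_Lp_sampler p C k n m M \<longrightarrow>
           ereal (c * real k powr max 1 (p - 1)) \<le> ereal_of_enat (comm_cost k n m M)"
proof -
  \<comment> \<open>An infinite cost exceeds any real bound, so only finite \<open>B\<close> need be
    treated.\<close>
  have suff: ?thesis
    if c: "c > 0" and le: "\<And>k. k \<ge> k0 \<Longrightarrow> \<exists>N. \<forall>n\<ge>N. \<forall>m\<ge>1. \<forall>M B.
      perfect_Lp_sampler p C k n m M \<longrightarrow> comm_cost k n m M \<le> enat B \<longrightarrow>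
      c * real k powr max 1 (p - 1) \<le> B" for c k0
  proof (rule exI[of _ c], rule conjI[OF c], rule exI[of _ k0], intro allI impI)
    fix k assume "k \<ge> k0"
    from le[OF this] obtain N where N: "\<And>n m M B. n \<ge> N \<Longrightarrow> m \<ge> 1 \<Longrightarrow>
        perfect_Lp_sampler p C k n m M \<Longrightarrow> comm_cost k n m M \<le> enat B \<Longrightarrow>
        c * real k powr max 1 (p - 1) \<le> B"
      by blast
    have "ereal (c * real k powr max 1 (p - 1)) \<le> ereal_of_enat (comm_cost k n m M)"
      if "n \<ge> N" "m \<ge> 1" "perfect_Lp_sampler p C k n m M" for n m M
      using N[OF that] by (cases "comm_cost k n m M") auto
    then show "\<exists>N. \<forall>n\<ge>N. \<forall>m\<ge>1. \<forall>M :: protocol measure. perfect_Lp_sampler p C k n m M \<longrightarrow>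
        ereal (c * real k powr max 1 (p - 1)) \<le> ereal_of_enat (comm_cost k n m M)"
      by blast
  qed
  show ?thesis
  proof (cases "p \<le> 2")
    case True
    then have max: "max 1 (p - 1) = 1" by simp
    obtain N where N: "\<And>n. n \<ge> N \<Longrightarrow> real n powr (- C) \<le> 1 / 8"
      using eventually_powr_neg_le[OF \<open>C > 0\<close>, of "1 / 8"] by auto
    show ?thesis
    \<comment> \<open>Error \<open>1 / 8\<close> leaves \<open>1 / 2 - 2 / 8 = 1 / 4\<close>, and
      \<open>k - 1 \<ge> k / 2\<close>.\<close>
    proof (rule suff[of "1 / 8" 2])
      fix k :: nat assume k: "k \<ge> 2"
      have "1 / 8 * real k \<le> B" if n: "n \<ge> max N 2" and m: "m \<ge> 1"
        and M: "perfect_Lp_sampler p C k n m M" "comm_cost k n m M \<le> enat B" for n m M B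
      proof -
        have "1 / 8 * real k \<le> (real k - 1) * (1 / 4)" using k by simp
        also have "\<dots> \<le> (real k - 1) * (1 / 2 - 2 * real n powr (- C))"
          using N[of n] n k by (intro mult_left_mono) auto
        also have "\<dots> \<le> B"
          using k n \<open>p \<ge> 1\<close> by (intro linear_bound[OF M _ _ _ m]) auto
        finally show ?thesis .
      qed
      then show "\<exists>N. \<forall>n\<ge>N. \<forall>m\<ge>1. \<forall>M B. perfect_Lp_sampler p C k n m M \<longrightarrow>
          comm_cost k n m M \<le> enat B \<longrightarrow> 1 / 8 * real k powr max 1 (p - 1) \<le> B"
        unfolding max using k by (intro exI[of _ "max N 2"]) auto
    qed simp
  next
    case False
    then have p: "p > 2" by simp
    then have max: "max 1 (p - 1) = p - 1" by simp
    define c where "c = share_const p"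
    have c: "c > 0" unfolding c_def by (rule share_const_pos)
    obtain N where N: "\<And>n. n \<ge> N \<Longrightarrow> real n powr (- C) \<le> c / 2"
      using eventually_powr_neg_le[OF \<open>C > 0\<close>, of "c / 2"] c by auto
    show ?thesis
    \<comment> \<open>The threshold gives \<open>c * k \<ge> 16\<close>, so the additive 2 is at
      most half of \<open>k powr p * c / 4\<close>; the rest yields \<open>c / 16\<close>.\<close>
    proof (rule suff[of "c / 16" "nat \<lceil>16 / c\<rceil> + 2"])
      fix k assume k0: "k \<ge> nat \<lceil>16 / c\<rceil> + 2"
      then have k: "k \<ge> 2" by simp
      have "16 / c \<le> k" using k0 by linarith
      then have kc: "16 \<le> c * k" using c by (simp add: field_simps)
      \<comment> \<open>The largest number of coordinates that keeps the noise bounded; rounding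
        down loses at most half.\<close>
      define s where "s = nat \<lfloor>real k powr p\<rfloor>"
      have kp: "real k powr p = k * real k powr (p - 1)"
        using k by (simp add: powr_diff)
      have "real k powr (p - 1) \<ge> 1" using k p by (intro ge_one_powr_ge_zero) auto
      then have kp1: "k \<le> real k powr p" unfolding kp using k by simp
      have s: "real s \<le> real k powr p" "real k powr p / 2 \<le> real s"
        using kp1 k unfolding s_def by linarith+
      have "c / 16 * real k powr (p - 1) \<le> B" if n: "n \<ge> max N (Suc s)" and m: "m \<ge> 1"
        and M: "perfect_Lp_sampler p C k n m M" "comm_cost k n m M \<le> enat B" for n m M B
      proof -
        have "real k powr p * c / 4 = real k powr p / 2 * (c / 2)" by simp
        also have "\<dots> \<le> s * (c - real n powr (- C))"
          using s N[of n] n c by (intro mult_mono) auto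
        also have "\<dots> \<le> 2 * (k * (B * ln 2) + 1)"
          unfolding c_def using p k s n by (intro superlinear_bound[OF M _ _ _ _ m]) auto
        also have "\<dots> \<le> 2 * (k * (real B * 1) + 1)"
          using ln_le_minus_one[of "2 :: real"]
          by (intro mult_left_mono add_right_mono) auto
        finally have "real k powr p * c / 4 \<le> 2 * k * B + 2" by simp
        moreover have "16 \<le> real k powr p * c"
          using kc kp1 c by (smt (verit) mult.commute mult_left_mono)
        ultimately have "real k powr p * c / 16 \<le> k * B" by simp
        then have "real k * (c / 16 * real k powr (p - 1)) \<le> real k * B"
          unfolding kp by (simp add: algebra_simps)
        then show ?thesis using k by simp
      qed
      then show "\<exists>N. \<forall>n\<ge>N. \<forall>m\<ge>1. \<forall>M B. perfect_Lp_sampler p C k n m M \<longrightarrow>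
          comm_cost k n m M \<le> enat B \<longrightarrow> c / 16 * real k powr max 1 (p - 1) \<le> B"
        unfolding max by (intro exI[of _ "max N (Suc s)"]) auto
    qed (use c in simp)
  qed
qed

end
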